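(* Let $q$ and $q+2$ be prime powers with $q\equiv 3\pmod 4$, let $\chi$ be the quadratic character of $\mathbb{F}_{q+2}^*$, and let $E$ and $F$ be inequivalent skew Hadamard difference sets in $(\mathbb{F}_q,+)$. Then the two difference sets $$D=\{(x,y)\mid x\in E,\ y\in\mathbb{F}_{q+2}^*,\ \chi(y)=1\}\cup\{(x,y)\mid x\in -E,\ y\in\mathbb{F}_{q+2}^*,\ \chi(y)=-1\}\cup\{(x,0)\mid x\in\mathbb{F}_q\}$$ and $$D'=\{(x,y)\mid x\in F,\ y\in\mathbb{F}_{q+2}^*,\ \chi(y)=1\}\cup\{(x,y)\mid x\in -F,\ y\in\mathbb{F}_{q+2}^*,\ \chi(y)=-1\}\cup\{(x,0)\mid x\in\mathbb{F}_q\}$$ in $G=(\mathbb{F}_q,+)\times(\mathbb{F}_{q+2},+)$ are inequivalent.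
   Context: A difference set $E$ in $(\mathbb{F}_q,+)$ is skew Hadamard if it is a difference set and $\mathbb{F}_q$ is the disjoint union of $E$, $-E$ and $\{0\}$. Two difference sets $D_1,D_2$ in an abelian group $G$ (written additively) are equivalent if there exist an automorphism $\sigma$ of $G$ and $g\in G$ with $\sigma(D_1)=D_2+g$. (The sets $D,D'$ above are difference sets in $G$ with parameters $(4n-1,2n-1,n-1)$, $n=(q+1)^2/4$.) *)

theory Defs
  imports
    "HOL-Library.Product_Plus"
    "HOL-Library.Cardinality"
    "HOL-Number_Theory.Prime_Powers"
    "HOL-Number_Theory.Cong"
begin

definition difference_set_params ::
    "nat \<Rightarrow> nat \<Rightarrow> nat \<Rightarrow> 'a::{finite,ab_group_add} set \<Rightarrow> bool" where
  "difference_set_params v k l D \<longleftrightarrow>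
     CARD('a) = v \<and> card D = k \<and>
     (\<forall>g. g \<noteq> 0 \<longrightarrow> card {(d, d'). d \<in> D \<and> d' \<in> D \<and> d - d' = g} = l)"

definition difference_set :: "'a::{finite,ab_group_add} set \<Rightarrow> bool" where
  "difference_set D \<longleftrightarrow> (\<exists>v k l. difference_set_params v k l D)"

definition skew_hadamard :: "'a::{finite,ab_group_add} set \<Rightarrow> bool" where
  "skew_hadamard E \<longleftrightarrow>
     difference_set E \<and>
     E \<union> uminus ` E \<union> {0} = UNIV \<and>
     E \<inter> uminus ` E = {} \<and> 0 \<notin> E \<and> 0 \<notin> uminus ` E"

(* Stated for arbitrary subsets, so that the negation carries no hidden side condition;
   it is only ever applied to difference sets. *)
definition equivalent_sets :: "'a::ab_group_add set \<Rightarrow> 'a set \<Rightarrow> bool" where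
  "equivalent_sets D1 D2 \<longleftrightarrow>
     (\<exists>\<sigma> g. additive \<sigma> \<and> bij \<sigma> \<and> \<sigma> ` D1 = (\<lambda>d. d + g) ` D2)"

(* The quadratic character lives on the nonzero elements; the value 0 at 0 is a
   totalization only. *)
definition quadratic_char :: "'b::field \<Rightarrow> int" where
  "quadratic_char y = (if y = 0 then 0 else if \<exists>z. y = z ^ 2 then 1 else -1)"

definition twin_prime_power_set :: "'a::ab_group_add set \<Rightarrow> ('a \<times> 'b::field) set" where
  "twin_prime_power_set E =
     {(x, y). x \<in> E \<and> y \<noteq> 0 \<and> quadratic_char y = 1} \<union>
     {(x, y). x \<in> uminus ` E \<and> y \<noteq> 0 \<and> quadratic_char y = -1} \<union>
     {(x, y). y = 0}"

end

theory Submission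
  imports Defs
begin

text \<open>
  Since \<open>q\<close> and \<open>q + 2\<close> are coprime, every automorphism of the product group splits as
  \<open>(x, y) \<mapsto> (\<alpha> x, \<beta> y)\<close>. The row of \<open>D\<close> over \<open>y = 0\<close> is the only full one, which forces the
  translation to be trivial in the second coordinate. Comparing the row of \<open>D\<close> over \<open>1\<close> with the
  row of \<open>D'\<close> over \<open>\<beta> 1 \<noteq> 0\<close> then shows that \<open>\<alpha>\<close> maps \<open>E\<close> to a translate of \<open>F\<close> or of \<open>-F\<close>,
  and in the second case \<open>-\<alpha>\<close> maps \<open>E\<close> to a translate of \<open>F\<close>.
\<close>

text \<open>Translation by 1 permutes the ring, so the sum of all elements does not change when each
  summand grows by 1; the total growth is \<open>of_nat CARD('a)\<close>.\<close>

lemma of_nat_CARD_eq_0: "of_nat CARD('a) = (0 :: 'a::{ring_1,finite})"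
proof -
  have "(\<Sum>x\<in>UNIV. x) = (\<Sum>x\<in>(UNIV :: 'a set). x + 1)"
    by (rule sum.reindex_bij_witness[of _ "\<lambda>x. x + 1" "\<lambda>x. x - 1"]) auto
  then show ?thesis
    by (simp add: sum.distrib)
qed

lemma additive_of_nat_mult:
  assumes "additive (f :: 'a::ring_1 \<Rightarrow> 'b::ring_1)"
  shows "f (of_nat n * x) = of_nat n * f x"
proof -
  interpret additive f by fact
  show ?thesis
    by (induction n) (simp_all add: zero add distrib_right)
qed

text \<open>Both cardinalities annihilate \<open>f x\<close>: that of the domain through additivity,
  that of the codomain directly. By Bezout, 1 annihilates it too.\<close>

lemma additive_coprime_CARD_eq_0:
  assumes f: "additive (f :: 'a::{ring_1,finite} \<Rightarrow> 'b::{ring_1,finite})"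
    and cop: "coprime CARD('a) CARD('b)"
  shows "f x = 0"
proof -
  interpret additive f by fact
  obtain u v where uv: "u * int CARD('a) + v * int CARD('b) = 1"
    using cop bezout_int[of "int CARD('a)" "int CARD('b)"]
    by (metis coprime_imp_gcd_eq_1 coprime_int_iff)
  have a: "of_nat CARD('a) * f x = 0"
    using additive_of_nat_mult[OF f, of "CARD('a)" x] by (simp add: of_nat_CARD_eq_0 zero)
  have "f x = of_int (u * int CARD('a) + v * int CARD('b)) * f x"
    by (simp add: uv)
  also have "\<dots> = of_int u * (of_nat CARD('a) * f x) + of_int v * (of_nat CARD('b) * f x)"
    by (simp add: distrib_right mult.assoc)
  also have "\<dots> = 0"
    unfolding a by (simp add: of_nat_CARD_eq_0)
  finally show ?thesis .
qed

text \<open>The two off-diagonal components of \<open>\<sigma>\<close> are additive maps between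
  groups of coprime order, hence zero.\<close>

lemma additive_prod_coprime_CARD_split:
  fixes \<sigma> :: "'a::{ring_1,finite} \<times> 'b::{ring_1,finite} \<Rightarrow> 'a \<times> 'b"
  assumes \<sigma>: "additive \<sigma>" and cop: "coprime CARD('a) CARD('b)"
  obtains \<alpha> \<beta> where "additive \<alpha>" "\<And>x y. \<sigma> (x, y) = (\<alpha> x, \<beta> y)"
proof
  interpret additive \<sigma> by fact
  show "additive (\<lambda>x. fst (\<sigma> (x, 0)))"
    by unfold_locales (simp flip: fst_add add)
  have "additive (\<lambda>x. snd (\<sigma> (x, 0)))"
    by unfold_locales (simp flip: snd_add add)
  then have 1: "snd (\<sigma> (x, 0)) = 0" for x
    using cop by (rule additive_coprime_CARD_eq_0)
  have "additive (\<lambda>y. fst (\<sigma> (0, y)))"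
    by unfold_locales (simp flip: fst_add add)
  then have 2: "fst (\<sigma> (0, y)) = 0" for y
    using cop by (intro additive_coprime_CARD_eq_0) (simp_all add: coprime_commute)
  show "\<sigma> (x, y) = (fst (\<sigma> (x, 0)), snd (\<sigma> (0, y)))" for x y
    using add[of "(x, 0)" "(0, y)"] 1 2 by (simp add: prod_eq_iff)
qed

text \<open>The last branch needs no test, since at a nonzero \<open>y\<close> the character is 1 or
  -1.\<close>

lemma twin_prime_power_set_row:
  "(x, y) \<in> twin_prime_power_set E \<longleftrightarrow>
     (if y = 0 then True else if quadratic_char y = 1 then x \<in> E else x \<in> uminus ` E)"
  by (auto simp: twin_prime_power_set_def quadratic_char_def)

text \<open>Following \<open>\<sigma>\<close> by negation turns the translate of \<open>-F\<close>
  by \<open>g\<close> into the translate of \<open>F\<close> by \<open>-g\<close>.\<close>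

lemma equivalent_sets_uminus_iff:
  "equivalent_sets E (uminus ` F) \<longleftrightarrow> equivalent_sets E F"
proof -
  have *: "equivalent_sets E F" if "equivalent_sets E (uminus ` F)" for F
  proof -
    from that obtain \<sigma> g where \<sigma>: "additive \<sigma>" "bij \<sigma>"
      "\<sigma> ` E = (\<lambda>d. d + g) ` uminus ` F"
      unfolding equivalent_sets_def by blast
    have "additive (\<lambda>x. - \<sigma> x)"
      using \<sigma>(1) by (simp add: additive_def)
    moreover have "bij (\<lambda>x. - \<sigma> x)"
      using bij_comp[OF \<sigma>(2) bij_uminus] by (simp add: o_def)
    moreover have "(\<lambda>x. - \<sigma> x) ` E = uminus ` \<sigma> ` E"
      by (simp add: image_image)
    then have "(\<lambda>x. - \<sigma> x) ` E = (\<lambda>d. d + - g) ` F"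
      by (simp add: \<sigma>(3) image_image)
    ultimately show ?thesis
      unfolding equivalent_sets_def by blast
  qed
  show ?thesis
    \<comment> \<open>The converse is the same implication for \<open>-F\<close>, as negating twice
      gives back \<open>F\<close>.\<close>
    using *[of F] *[of "uminus ` F"] by (auto simp: image_image)
qed

lemma equivalent_sets_of_twin_prime_power_set:
  fixes E F :: "'a::{ring_1,finite} set"
  assumes cop: "coprime CARD('a) CARD('b)"
    and F0: "0 \<notin> F"
    and eq: "equivalent_sets (twin_prime_power_set E :: ('a \<times> 'b::{field,finite}) set)
               (twin_prime_power_set F)"
  shows "equivalent_sets E F"
proof -
  let ?D = "twin_prime_power_set :: 'a set \<Rightarrow> ('a \<times> 'b) set"
  obtain \<sigma> g where \<sigma>: "additive \<sigma>" "bij \<sigma>" "\<sigma> ` ?D E = (\<lambda>d. d + g) ` ?D F"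
    using eq unfolding equivalent_sets_def by blast
  obtain \<alpha> \<beta> where \<alpha>: "additive \<alpha>" and split: "\<And>x y. \<sigma> (x, y) = (\<alpha> x, \<beta> y)"
    using additive_prod_coprime_CARD_split[OF \<sigma>(1) cop] by blast
  obtain a b where g: "g = (a, b)" by fastforce
  have \<sigma>0: "\<sigma> 0 = 0" and \<alpha>0: "\<alpha> 0 = 0"
    using additive.zero[OF \<sigma>(1)] additive.zero[OF \<alpha>] .
  then have \<beta>0: "\<beta> 0 = 0"
    using split[of 0 0] by (simp add: zero_prod_def)
  have inj: "inj \<sigma>"
    using \<sigma>(2) by (rule bij_is_inj)
  have "inj \<alpha>"
  proof (rule injI)
    fix x x' assume "\<alpha> x = \<alpha> x'"
    then have "\<sigma> (x, 0) = \<sigma> (x', 0)" by (simp add: split)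
    then show "x = x'" using inj by (auto dest: injD)
  qed
  then have bij: "bij \<alpha>"
    by (simp add: bij_def finite_UNIV_inj_surj)
  have \<beta>1: "\<beta> 1 \<noteq> 0"
  proof
    assume "\<beta> 1 = 0"
    then have "\<sigma> (0, 1) = \<sigma> (0, 0)" by (simp add: split \<beta>0)
    then show False using inj by (auto dest: injD)
  qed
  have row: "(x, y) \<in> ?D E \<longleftrightarrow> (\<alpha> x - a, \<beta> y - b) \<in> ?D F" for x y
  proof -
    have "(x, y) \<in> ?D E \<longleftrightarrow> (\<alpha> x, \<beta> y) \<in> \<sigma> ` ?D E"
      using inj by (simp add: inj_image_mem_iff flip: split)
    also have "\<dots> \<longleftrightarrow> (\<alpha> x - a, \<beta> y - b) \<in> ?D F"
      unfolding \<sigma>(3) g by (force simp: image_iff)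
    finally show ?thesis .
  qed
  have "b = 0"
  proof (rule ccontr)
    assume "b \<noteq> 0"
    \<comment> \<open>The full row over 0 would correspond to the row over \<open>-b\<close>, which
      is \<open>F\<close> or \<open>-F\<close>. This \<open>x\<close> is sent to 0, which lies in
      neither.\<close>
    obtain x where "\<alpha> x = a"
      using bij by (metis bij_pointE)
    then show False
      using row[of x 0] F0 \<open>b \<noteq> 0\<close>
      by (auto simp: twin_prime_power_set_row \<beta>0 split: if_splits)
  qed
  \<comment> \<open>As 1 is a square, the row of \<open>?D E\<close> over it is \<open>E\<close>
    itself.\<close>
  have "quadratic_char (1 :: 'b) = 1"
    by (auto simp: quadratic_char_def intro: exI[of _ 1])
  then have E: "x \<in> E \<longleftrightarrow> \<alpha> x - a \<in> (if quadratic_char (\<beta> 1) = 1 then F else uminus ` F)" for x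
    using row[of x 1] \<open>b = 0\<close> \<beta>1 by (auto simp: twin_prime_power_set_row)
  \<comment> \<open>The set \<open>H\<close> stands for \<open>F\<close> or \<open>-F\<close>,
    according to whether \<open>\<beta> 1\<close> is a square.\<close>
  have translate: "equivalent_sets E H" if "\<And>x. x \<in> E \<longleftrightarrow> \<alpha> x - a \<in> H" for H
  proof -
    have "\<alpha> ` E = (\<lambda>d. d + a) ` H"
    proof (intro set_eqI)
      fix z
      obtain x where "z = \<alpha> x" using bij by (metis bij_pointE)
      then show "z \<in> \<alpha> ` E \<longleftrightarrow> z \<in> (\<lambda>d. d + a) ` H"
        using inj_image_mem_iff[OF \<open>inj \<alpha>\<close>, of x E] that[of x]
        by (auto intro: image_eqI[of _ _ "\<alpha> x - a"])
    qed
    then show ?thesis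
      unfolding equivalent_sets_def using \<alpha> bij by blast
  qed
  show ?thesis
    using translate[of F] translate[of "uminus ` F"] E equivalent_sets_uminus_iff[of E F]
    by (cases "quadratic_char (\<beta> 1) = 1") simp_all
qed

theorem theorem5p3:
  fixes q :: nat
    and E F :: "'a::{field,finite} set"
    and D D' :: "('a \<times> 'b::{field,finite}) set"
  assumes "primepow q" and "primepow (q + 2)" and "[q = 3] (mod 4)"
    and "CARD('a) = q" and "CARD('b) = q + 2"
    and "skew_hadamard E" and "skew_hadamard F"
    and "\<not> equivalent_sets E F"
    and "D = twin_prime_power_set E" and "D' = twin_prime_power_set F"
  shows "\<not> equivalent_sets D D'"
proof
  assume eq: "equivalent_sets D D'"
  \<comment> \<open>A common divisor of \<open>q\<close> and \<open>q + 2\<close> divides 2, so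
    oddness makes them coprime.\<close>
  have "odd q"
    using assms(3) by (simp add: cong_def) presburger
  then have "coprime q (q + 2)"
    by (simp add: coprime_iff_gcd_eq_1[of q "q + 2"] gcd_add2 coprime_imp_gcd_eq_1 del: add_2_eq_Suc')
  then have "coprime CARD('a) CARD('b)"
    by (simp add: assms)
  moreover have "0 \<notin> F"
    using assms(7) by (simp add: skew_hadamard_def)
  ultimately have "equivalent_sets E F"
    using eq equivalent_sets_of_twin_prime_power_set unfolding assms(9,10) by blast
  with assms(8) show False by simp
qed

end
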